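(* Let $S$ be a non-degenerate regular tubular surface of radius $r>0$ and signal $\varepsilon\in\{-1,1\}$ in Lorentzian $3$-space, with Gaussian curvature $K$ and mean curvature $H$, and let $\mathcal{Q}_L(S)$ be the set of all polynomials $Q\in\mathbb{R}[x,y]$ satisfying $Q(K,H)\equiv0$. For $Q\in\mathbb{R}[x,y]$ put $Rad_{L,\varepsilon}(Q)=\{\rho\in(0,+\infty)\,:\,Q(0,\tfrac{\varepsilon}{2\rho})=0\}$. (i) If $S$ is a right cylinder, then $\mathcal{Q}_L(S)=\{Q\in\mathbb{R}[x,y]\,:\,r\in Rad_{L,\varepsilon}(Q)\}$. (ii) If $S$ is not a right cylinder, then $\mathcal{Q}_L(S)$ is the ideal of $\mathbb{R}[x,y]$ generated by the polynomial $xr^2-2ry+\varepsilon$.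
   Context: Lorentzian $3$-space $\mathbb{L}^3$ is $\mathbb{R}^3$ with $\langle u,v\rangle_1=u_1v_1+u_2v_2-u_3v_3$. Let $\gamma:(a,b)\to\mathbb{L}^3$ be a smooth curve parametrized by arc length which is spacelike or timelike, i.e. $\varepsilon_T:=\langle\gamma',\gamma'\rangle_1$ is constantly $1$ or constantly $-1$ (the central curve). Let $r>0$ and $\varepsilon\in\{-1,1\}$. The tubular surface of radius $r$ around $\gamma$ with signal $\varepsilon$ is the union over $s\in(a,b)$ of the normal sections $$S_r(\gamma(s))=\{x:\ \langle x-\gamma(s),\gamma'(s)\rangle_1=0,\ \langle x-\gamma(s),x-\gamma(s)\rangle_1=\varepsilon r^2\},$$ which are called Lorentzian circles if $\varepsilon=1$ and Lorentzian hyperboles if $\varepsilon=-1$ (the latter occur only when $\gamma$ is spacelike); when the sections have two branches, the surface may also consist of just one branch, chosen continuously in $s$. The surface is parametrized by pairs $(s,v)$, $v=x-\gamma(s)$. It is regular if $1-\varepsilon_T\langle\gamma''(s),v\rangle_1\neq0$ for all its pairs $(s,v)$; the parametrization is then an immersion and the surface is non-degenerate (spacelike or timelike). Its unit normal is $\mathcal{N}=-v/r$, so $\langle\mathcal{N},\mathcal{N}\rangle_1=\varepsilon$ (the signal). With $\psi$ a local parametrization in coordinates $(s,t)$, $E=\langle\psi_s,\psi_s\rangle_1$, $F=\langle\psi_s,\psi_t\rangle_1$, $G=\langle\psi_t,\psi_t\rangle_1$, $e=\langle\psi_{ss},\mathcal{N}\rangle_1$, $f=\langle\psi_{st},\mathcal{N}\rangle_1$,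 $g=\langle\psi_{tt},\mathcal{N}\rangle_1$, the Gaussian and mean curvatures are $$K=\varepsilon\frac{eg-f^2}{EG-F^2},\qquad H=\varepsilon\frac{eG-2fF+gE}{2(EG-F^2)}.$$ A right cylinder is a regular tubular surface whose central curve is a geodesic, i.e. $\gamma''\equiv0$. *)

theory Defs
  imports "HOL-Analysis.Analysis" "HOL-Computational_Algebra.Polynomial"
begin

section \<open>Smooth maps\<close>

text \<open>For open \<open>S\<close>: all iterated directional derivatives up to order \<open>n\<close> exist and are continuous.\<close>

primrec Ck_on :: "nat \<Rightarrow> 'a::real_normed_vector set \<Rightarrow> ('a \<Rightarrow> 'b::real_normed_vector) \<Rightarrow> bool" where
  "Ck_on 0 S f \<longleftrightarrow> continuous_on S f"
| "Ck_on (Suc n) S f \<longleftrightarrow>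
     (\<forall>x\<in>S. f differentiable (at x)) \<and> (\<forall>h. Ck_on n S (\<lambda>x. frechet_derivative f (at x) h))"

definition smooth_on :: "'a::real_normed_vector set \<Rightarrow> ('a \<Rightarrow> 'b::real_normed_vector) \<Rightarrow> bool" where
  "smooth_on S f \<longleftrightarrow> (\<forall>n. Ck_on n S f)"

section \<open>Tubular surfaces in Lorentzian 3-space\<close>

definition lorentz :: "real^3 \<Rightarrow> real^3 \<Rightarrow> real" where
  "lorentz u v = u$1 * v$1 + u$2 * v$2 - u$3 * v$3"

definition velocity :: "(real \<Rightarrow> real^3) \<Rightarrow> real \<Rightarrow> real^3" where
  "velocity \<gamma> s = vector_derivative \<gamma> (at s)"

definition acceleration :: "(real \<Rightarrow> real^3) \<Rightarrow> real \<Rightarrow> real^3" where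
  "acceleration \<gamma> s = vector_derivative (velocity \<gamma>) (at s)"

text \<open>The end points may be infinite, so that complete central curves are included.\<close>

definition central_curve :: "ereal \<Rightarrow> ereal \<Rightarrow> (real \<Rightarrow> real^3) \<Rightarrow> real \<Rightarrow> bool" where
  "central_curve a b \<gamma> \<epsilon>\<^sub>T \<longleftrightarrow>
     a < b \<and> smooth_on (einterval a b) \<gamma> \<and> \<epsilon>\<^sub>T \<in> {-1, 1} \<and>
     (\<forall>s\<in>einterval a b. lorentz (velocity \<gamma> s) (velocity \<gamma> s) = \<epsilon>\<^sub>T)"

definition normal_section :: "(real \<Rightarrow> real^3) \<Rightarrow> real \<Rightarrow> real \<Rightarrow> real \<Rightarrow> (real^3) set" where
  "normal_section \<gamma> r \<epsilon> s =
     {x. lorentz (x - \<gamma> s) (velocity \<gamma> s) = 0 \<and> lorentz (x - \<gamma> s) (x - \<gamma> s) = \<epsilon> * r^2}"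

text \<open>
  A tubular surface is given by its set \<open>P\<close> of pairs \<open>(s, v)\<close>, where \<open>v = x - \<gamma> s\<close>. It consists
  either of the full normal sections \<open>X s\<close>, or of one branch (connected component) of each of
  them, chosen continuously: the branch at \<open>s\<close> is the one containing \<open>w s\<close>, with \<open>w\<close> continuous.
  If \<open>\<gamma>\<close> is timelike, then the sections are connected and the two alternatives coincide; they
  would be empty for \<open>\<epsilon> = -1\<close>, which is therefore excluded.
\<close>

definition tubular_surface ::
  "ereal \<Rightarrow> ereal \<Rightarrow> (real \<Rightarrow> real^3) \<Rightarrow> real \<Rightarrow> real \<Rightarrow> real \<Rightarrow> (real \<times> (real^3)) set \<Rightarrow> bool" where
  "tubular_surface a b \<gamma> \<epsilon>\<^sub>T r \<epsilon> P \<longleftrightarrow>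
     central_curve a b \<gamma> \<epsilon>\<^sub>T \<and> r > 0 \<and> \<epsilon> \<in> {-1, 1} \<and> (\<epsilon> = -1 \<longrightarrow> \<epsilon>\<^sub>T = 1) \<and>
     (\<exists>X. P = {(s, v). s \<in> einterval a b \<and> \<gamma> s + v \<in> X s} \<and>
        ((\<forall>s\<in>einterval a b. X s = normal_section \<gamma> r \<epsilon> s) \<or>
         (\<exists>w. continuous_on (einterval a b) w \<and>
            (\<forall>s\<in>einterval a b. w s \<in> normal_section \<gamma> r \<epsilon> s \<and>
               X s = connected_component_set (normal_section \<gamma> r \<epsilon> s) (w s)))))"

definition regular_tubular_surface ::
  "ereal \<Rightarrow> ereal \<Rightarrow> (real \<Rightarrow> real^3) \<Rightarrow> real \<Rightarrow> real \<Rightarrow> real \<Rightarrow> (real \<times> (real^3)) set \<Rightarrow> bool" where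
  "regular_tubular_surface a b \<gamma> \<epsilon>\<^sub>T r \<epsilon> P \<longleftrightarrow>
     tubular_surface a b \<gamma> \<epsilon>\<^sub>T r \<epsilon> P \<and>
     (\<forall>(s, v)\<in>P. 1 - \<epsilon>\<^sub>T * lorentz (acceleration \<gamma> s) v \<noteq> 0)"

definition right_cylinder ::
  "ereal \<Rightarrow> ereal \<Rightarrow> (real \<Rightarrow> real^3) \<Rightarrow> real \<Rightarrow> real \<Rightarrow> real \<Rightarrow> (real \<times> (real^3)) set \<Rightarrow> bool" where
  "right_cylinder a b \<gamma> \<epsilon>\<^sub>T r \<epsilon> P \<longleftrightarrow>
     regular_tubular_surface a b \<gamma> \<epsilon>\<^sub>T r \<epsilon> P \<and> (\<forall>s\<in>einterval a b. acceleration \<gamma> s = 0)"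

section \<open>Local parametrizations and curvatures\<close>

definition partial_s :: "(real \<times> real \<Rightarrow> real^3) \<Rightarrow> real \<times> real \<Rightarrow> real^3" where
  "partial_s \<psi> p = frechet_derivative \<psi> (at p) (1, 0)"

definition partial_t :: "(real \<times> real \<Rightarrow> real^3) \<Rightarrow> real \<times> real \<Rightarrow> real^3" where
  "partial_t \<psi> p = frechet_derivative \<psi> (at p) (0, 1)"

text \<open>
  The first coordinate is the parameter \<open>s\<close> of the central curve. Injectivity is required at the
  level of pairs, because the surface may have self-intersections as a subset of space.
\<close>

definition local_parametrization ::
  "(real \<Rightarrow> real^3) \<Rightarrow> (real \<times> (real^3)) set \<Rightarrow> (real \<times> real) set \<Rightarrow> (real \<times> real \<Rightarrow> real^3) \<Rightarrow> bool" where
  "local_parametrization \<gamma> P U \<psi> \<longleftrightarrow>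
     open U \<and> smooth_on U \<psi> \<and>
     (\<forall>(s, t)\<in>U. (s, \<psi> (s, t) - \<gamma> s) \<in> P) \<and>
     inj_on (\<lambda>(s, t). (s, \<psi> (s, t) - \<gamma> s)) U \<and>
     (\<forall>p\<in>U. inj (frechet_derivative \<psi> (at p)))"

definition unit_normal :: "(real \<Rightarrow> real^3) \<Rightarrow> real \<Rightarrow> (real \<times> real \<Rightarrow> real^3) \<Rightarrow> real \<times> real \<Rightarrow> real^3" where
  "unit_normal \<gamma> r \<psi> p = - ((\<psi> p - \<gamma> (fst p)) /\<^sub>R r)"

definition metric_det :: "(real \<times> real \<Rightarrow> real^3) \<Rightarrow> real \<times> real \<Rightarrow> real" where
  "metric_det \<psi> p =
     (let E = lorentz (partial_s \<psi> p) (partial_s \<psi> p);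
          F = lorentz (partial_s \<psi> p) (partial_t \<psi> p);
          G = lorentz (partial_t \<psi> p) (partial_t \<psi> p)
      in E * G - F^2)"

definition nondegenerate :: "(real \<Rightarrow> real^3) \<Rightarrow> (real \<times> (real^3)) set \<Rightarrow> bool" where
  "nondegenerate \<gamma> P \<longleftrightarrow>
     (\<forall>U \<psi>. local_parametrization \<gamma> P U \<psi> \<longrightarrow> (\<forall>p\<in>U. metric_det \<psi> p \<noteq> 0))"

definition gauss_curvature ::
  "(real \<Rightarrow> real^3) \<Rightarrow> real \<Rightarrow> real \<Rightarrow> (real \<times> real \<Rightarrow> real^3) \<Rightarrow> real \<times> real \<Rightarrow> real" where
  "gauss_curvature \<gamma> r \<epsilon> \<psi> p =
     (let N = unit_normal \<gamma> r \<psi> p;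
          e = lorentz (partial_s (partial_s \<psi>) p) N;
          f = lorentz (partial_t (partial_s \<psi>) p) N;
          g = lorentz (partial_t (partial_t \<psi>) p) N
      in \<epsilon> * ((e * g - f^2) / metric_det \<psi> p))"

definition mean_curvature ::
  "(real \<Rightarrow> real^3) \<Rightarrow> real \<Rightarrow> real \<Rightarrow> (real \<times> real \<Rightarrow> real^3) \<Rightarrow> real \<times> real \<Rightarrow> real" where
  "mean_curvature \<gamma> r \<epsilon> \<psi> p =
     (let N = unit_normal \<gamma> r \<psi> p;
          E = lorentz (partial_s \<psi> p) (partial_s \<psi> p);
          F = lorentz (partial_s \<psi> p) (partial_t \<psi> p);
          G = lorentz (partial_t \<psi> p) (partial_t \<psi> p);
          e = lorentz (partial_s (partial_s \<psi>) p) N;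
          f = lorentz (partial_t (partial_s \<psi>) p) N;
          g = lorentz (partial_t (partial_t \<psi>) p) N
      in \<epsilon> * ((e * G - 2 * f * F + g * E) / (2 * metric_det \<psi> p)))"

section \<open>Polynomials in two variables\<close>

text \<open>
  \<open>\<real>[x, y]\<close> is rendered as \<open>\<real>[x][y]\<close>: the inner variable of a \<open>real poly poly\<close> is \<open>x\<close>, the
  outer one is \<open>y\<close>.
\<close>

definition eval2 :: "real poly poly \<Rightarrow> real \<Rightarrow> real \<Rightarrow> real" where
  "eval2 Q x y = poly (poly Q [:y:]) x"

definition polyX :: "real poly poly" where "polyX = [:[:0, 1:]:]"

definition polyY :: "real poly poly" where "polyY = [:0, 1:]"

definition polyC :: "real \<Rightarrow> real poly poly" where "polyC c = [:[:c:]:]"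

lemma eval2_simps [simp]:
  "eval2 polyX x y = x" "eval2 polyY x y = y" "eval2 (polyC c) x y = c"
  "eval2 (P + Q) x y = eval2 P x y + eval2 Q x y"
  "eval2 (P - Q) x y = eval2 P x y - eval2 Q x y"
  "eval2 (P * Q) x y = eval2 P x y * eval2 Q x y"
  by (simp_all add: eval2_def polyX_def polyY_def polyC_def)

text \<open>The ideals of a commutative ring are its submodules as a module over itself.\<close>

lemma module_times: "module ((*) :: 'a::comm_ring_1 \<Rightarrow> 'a \<Rightarrow> 'a)"
  by unfold_locales (simp_all add: algebra_simps)

definition ideal_generated :: "'a::comm_ring_1 set \<Rightarrow> 'a set" where
  "ideal_generated G = module.span (*) G"

lemma ideal_generated_eq_hull:
  "ideal_generated G = (\<lambda>I. 0 \<in> I \<and> (\<forall>p\<in>I. \<forall>q\<in>I. p + q \<in> I) \<and> (\<forall>c. \<forall>p\<in>I. c * p \<in> I)) hull G"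
proof -
  interpret module "(*) :: 'a \<Rightarrow> 'a \<Rightarrow> 'a" by (rule module_times)
  show ?thesis by (simp add: ideal_generated_def span_def subspace_def[abs_def])
qed

text \<open>
  \<open>Q(K, H) \<equiv> 0\<close> means vanishing in every local parametrization; a tubular surface is covered by
  local parametrizations, and \<open>K\<close>, \<open>H\<close> do not depend on the parametrization chosen.
\<close>

definition QL ::
  "(real \<Rightarrow> real^3) \<Rightarrow> real \<Rightarrow> real \<Rightarrow> (real \<times> (real^3)) set \<Rightarrow> real poly poly set" where
  "QL \<gamma> r \<epsilon> P =
     {Q. \<forall>U \<psi>. local_parametrization \<gamma> P U \<psi> \<longrightarrow>
           (\<forall>p\<in>U. eval2 Q (gauss_curvature \<gamma> r \<epsilon> \<psi> p) (mean_curvature \<gamma> r \<epsilon> \<psi> p) = 0)}"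

definition RadL :: "real \<Rightarrow> real poly poly \<Rightarrow> real set" where
  "RadL \<epsilon> Q = {\<rho>. \<rho> > 0 \<and> eval2 Q 0 (\<epsilon> / (2 * \<rho>)) = 0}"

end

theory Submission
  imports Defs
begin

text \<open>
  Write \<open>T = \<gamma>'\<close> and \<open>m = \<epsilon>\<^sub>T - \<langle>\<gamma>'', v\<rangle>\<close>. Differentiating \<open>\<langle>v, T\<rangle> = 0\<close> and \<open>\<langle>v, v\<rangle> = \<epsilon> r\<^sup>2\<close> expresses the
  second fundamental form through the first: \<open>e = (E - m) / r\<close>, \<open>f = F / r\<close>, \<open>g = G / r\<close>. Since
  \<open>\<psi>\<^sub>s\<close>, \<open>\<psi>\<^sub>t\<close> and \<open>T\<close> are all orthogonal to \<open>v\<close>, their Gram determinant vanishes, which gives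
  \<open>E G - F\<^sup>2 = \<epsilon>\<^sub>T m\<^sup>2 G\<close>. Hence \<open>K = (\<epsilon> / r\<^sup>2) (1 - \<epsilon>\<^sub>T / m)\<close> and \<open>H = (\<epsilon> / 2 r) (2 - \<epsilon>\<^sub>T / m)\<close>, so
  \<open>(K, H)\<close> always lies on the line \<open>r\<^sup>2 x - 2 r y + \<epsilon> = 0\<close>. Where \<open>\<gamma>'' \<noteq> 0\<close>, the linear form \<open>\<langle>\<gamma>'', v\<rangle>\<close>
  is not constant along an arc of the normal conic, so \<open>K\<close> takes infinitely many values and a
  polynomial vanishing at all \<open>(K, H)\<close> is divisible by the equation of the line.
\<close>

section \<open>Calculus of smooth maps\<close>

lemma Ck_on_SucD: "Ck_on (Suc n) S f \<Longrightarrow> Ck_on n S f"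
proof (induction n arbitrary: f)
  case 0
  then show ?case
    by (auto intro!: continuous_at_imp_continuous_on differentiable_imp_continuous_within)
next
  case (Suc n)
  then show ?case by (metis Ck_on.simps(2))
qed

text \<open>Derivatives at points of an open set depend only on values in that set, so in the
  induction the directional derivatives of \<open>f\<close> and \<open>g\<close> agree on
  \<open>S\<close> again.\<close>

lemma Ck_on_cong:
  assumes "open S" "Ck_on n S f" "\<And>x. x \<in> S \<Longrightarrow> f x = g x"
  shows "Ck_on n S g"
  using assms(2,3)
proof (induction n arbitrary: f g)
  case 0
  then show ?case using continuous_on_cong by (metis Ck_on.simps(1))
next
  case (Suc n)
  have D: "(g has_derivative frechet_derivative f (at x)) (at x)" if "x \<in> S" for x
  proof (rule has_derivative_transform_within_open[OF _ assms(1) that])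
    show "(f has_derivative frechet_derivative f (at x)) (at x)"
      using Suc.prems(1) that frechet_derivative_works by auto
  qed (rule Suc.prems(2))
  have "Ck_on n S (\<lambda>x. frechet_derivative g (at x) h)" for h
    by (rule Suc.IH[of "\<lambda>x. frechet_derivative f (at x) h"])
      (use Suc.prems(1) frechet_derivative_at[OF D] in auto)
  with D show ?case by (auto simp: differentiable_def)
qed

text \<open>Allows an explicit derivative \<open>f'\<close> in place of the one chosen by
  \<open>frechet_derivative\<close>, as the closure rules below need.\<close>

lemma Ck_on_SucI:
  assumes "open S" and "\<And>x. x \<in> S \<Longrightarrow> (f has_derivative f' x) (at x)"
    and "\<And>h. Ck_on n S (\<lambda>x. f' x h)"
  shows "Ck_on (Suc n) S f"
proof -
  have "frechet_derivative f (at x) = f' x" if "x \<in> S" for x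
    using assms(2)[OF that] frechet_derivative_at by metis
  then have "Ck_on n S (\<lambda>x. frechet_derivative f (at x) h)" for h
    using Ck_on_cong[OF assms(1) assms(3)[of h]] by simp
  then show ?thesis
    using assms(2) by (auto simp: differentiable_def)
qed

lemma Ck_on_const: "open S \<Longrightarrow> Ck_on n S (\<lambda>x. c)"
proof (induction n arbitrary: c)
  case (Suc n)
  then show ?case
    by (intro Ck_on_SucI[where f' = "\<lambda>_ _. 0"]) auto
qed simp

lemma Ck_on_linear:
  assumes "open S" "bounded_linear f"
  shows "Ck_on n S f"
proof (cases n)
  case 0
  then show ?thesis using assms by (simp add: linear_continuous_on)
next
  case (Suc m)
  show ?thesis unfolding Suc
    using assms
    by (intro Ck_on_SucI[where f' = "\<lambda>_. f"])
      (auto intro: bounded_linear_imp_has_derivative Ck_on_const)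
qed

lemma Ck_on_add:
  assumes "open S" "Ck_on n S f" "Ck_on n S g"
  shows "Ck_on n S (\<lambda>x. f x + g x)"
  using assms(2,3)
proof (induction n arbitrary: f g)
  case 0
  then show ?case by (simp add: continuous_on_add)
next
  case (Suc n)
  then show ?case
    by (intro Ck_on_SucI[where f' = "\<lambda>x h. frechet_derivative f (at x) h + frechet_derivative g (at x) h"])
      (auto intro!: has_derivative_add Suc.IH assms(1) simp: frechet_derivative_works[symmetric])
qed

text \<open>By the product rule the derivative is a sum of two terms of the same bilinear shape, so
  the induction hypothesis applies to each. This one rule covers products, scalings and
  \<open>lorentz\<close>.\<close>

lemma Ck_on_bilinear:
  assumes "bounded_bilinear B" "open S" "Ck_on n S f" "Ck_on n S g"
  shows "Ck_on n S (\<lambda>x. B (f x) (g x))"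
  using assms(3,4)
proof (induction n arbitrary: f g)
  case 0
  then show ?case
    using bounded_bilinear.continuous_on[OF assms(1)] by auto
next
  case (Suc n)
  show ?case
  proof (rule Ck_on_SucI[OF assms(2)])
    show "((\<lambda>x. B (f x) (g x)) has_derivative
        (\<lambda>h. B (f x) (frechet_derivative g (at x) h) + B (frechet_derivative f (at x) h) (g x))) (at x)"
      if "x \<in> S" for x
      using Suc.prems that
      by (intro bounded_bilinear.FDERIV[OF assms(1)]) (auto simp: frechet_derivative_works[symmetric])
    show "Ck_on n S (\<lambda>x. B (f x) (frechet_derivative g (at x) h) + B (frechet_derivative f (at x) h) (g x))"
      for h
      using Suc.prems Ck_on_SucD[OF Suc.prems(1)] Ck_on_SucD[OF Suc.prems(2)]
      by (intro Ck_on_add[OF assms(2)] Suc.IH) auto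
  qed
qed

text \<open>The derivative is \<open>- 1 / 2\<close> times the cube of the function itself times the
  derivative of \<open>f\<close>. Hence the induction closes using the product rule alone.\<close>

lemma Ck_on_inverse_sqrt:
  fixes f :: "'a::real_normed_vector \<Rightarrow> real"
  assumes "open S" "Ck_on n S f" and pos: "\<And>x. x \<in> S \<Longrightarrow> f x > 0"
  shows "Ck_on n S (\<lambda>x. inverse (sqrt (f x)))"
  using assms(2)
proof (induction n)
  case 0
  then show ?case using pos by (force intro!: continuous_intros)
next
  case (Suc n)
  let ?g = "\<lambda>x. inverse (sqrt (f x))"
  have g: "Ck_on n S ?g" using Suc.IH Ck_on_SucD[OF Suc.prems] by simp
  show ?case
  proof (rule Ck_on_SucI[OF assms(1)])
    show "(?g has_derivative
        (\<lambda>h. (- 1 / 2) * (?g x * (?g x * ?g x)) * frechet_derivative f (at x) h)) (at x)"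
      if "x \<in> S" for x
    proof -
      have "(f has_derivative frechet_derivative f (at x)) (at x)"
        using Suc.prems that by (auto simp: frechet_derivative_works[symmetric])
      then show ?thesis
        using pos[OF that]
        by (auto intro!: derivative_eq_intros simp: fun_eq_iff field_simps)
    qed
    show "Ck_on n S (\<lambda>x. (- 1 / 2) * (?g x * (?g x * ?g x)) * frechet_derivative f (at x) h)" for h
      using Suc.prems g
      by (intro Ck_on_bilinear[OF bounded_bilinear_mult assms(1)] Ck_on_const[OF assms(1)]) simp_all
  qed
qed

lemma Ck_on_compose_linear:
  assumes "bounded_linear L" "open S" "open V" "L ` V \<subseteq> S" "Ck_on n S f"
  shows "Ck_on n V (\<lambda>x. f (L x))"
  using assms(5)
proof (induction n arbitrary: f)
  case 0
  then show ?case
    using assms continuous_on_compose2 linear_continuous_on by (metis Ck_on.simps(1))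
next
  case (Suc n)
  show ?case
  proof (rule Ck_on_SucI[OF assms(3)])
    show "((\<lambda>x. f (L x)) has_derivative (\<lambda>h. frechet_derivative f (at (L x)) (L h))) (at x)"
      if "x \<in> V" for x
      using Suc.prems that assms(1,4)
      by (intro has_derivative_compose[of L L x UNIV f] bounded_linear_imp_has_derivative)
        (auto simp: frechet_derivative_works[symmetric])
    show "Ck_on n V (\<lambda>x. frechet_derivative f (at (L x)) (L h))" for h
      by (rule Suc.IH[of "\<lambda>y. frechet_derivative f (at y) (L h)"]) (use Suc.prems in simp)
  qed
qed

section \<open>Smooth maps: rules inherited from every finite order\<close>

lemma smooth_on_has_derivative:
  assumes "smooth_on S f" "x \<in> S"
  shows "(f has_derivative frechet_derivative f (at x)) (at x)"
  using assms unfolding smooth_on_def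
  by (metis Ck_on.simps(2) frechet_derivative_works)

lemma smooth_on_derivative:
  "smooth_on S f \<Longrightarrow> smooth_on S (\<lambda>x. frechet_derivative f (at x) h)"
  unfolding smooth_on_def by (metis Ck_on.simps(2))

lemma smooth_on_cong:
  "open S \<Longrightarrow> smooth_on S f \<Longrightarrow> (\<And>x. x \<in> S \<Longrightarrow> f x = g x) \<Longrightarrow> smooth_on S g"
  unfolding smooth_on_def using Ck_on_cong by blast

lemma smooth_on_has_vector_derivative:
  assumes "smooth_on S f" "x \<in> S"
  shows "(f has_derivative (\<lambda>h. h *\<^sub>R vector_derivative f (at x))) (at x)"
  using assms smooth_on_has_derivative
  by (metis differentiable_def has_vector_derivative_def vector_derivative_works)

lemma smooth_on_vector_derivative:
  assumes "open S" "smooth_on S f"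
  shows "smooth_on S (\<lambda>x. vector_derivative f (at x))"
proof (rule smooth_on_cong[OF assms(1) smooth_on_derivative[OF assms(2), of 1]])
  show "frechet_derivative f (at x) 1 = vector_derivative f (at x)" if "x \<in> S" for x
    using frechet_derivative_at[OF smooth_on_has_vector_derivative[OF assms(2) that], symmetric]
    by simp
qed

lemma Ck_on_subset: "T \<subseteq> S \<Longrightarrow> Ck_on n S f \<Longrightarrow> Ck_on n T f"
  by (induction n arbitrary: f) (auto intro: continuous_on_subset)

lemma smooth_on_subset: "T \<subseteq> S \<Longrightarrow> smooth_on S f \<Longrightarrow> smooth_on T f"
  unfolding smooth_on_def using Ck_on_subset by blast

lemma smooth_on_imp_continuous_on: "smooth_on S f \<Longrightarrow> continuous_on S f"
  unfolding smooth_on_def by (metis Ck_on.simps(1))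

lemma smooth_on_const: "open S \<Longrightarrow> smooth_on S (\<lambda>x. c)"
  by (simp add: smooth_on_def Ck_on_const)

lemma smooth_on_linear: "open S \<Longrightarrow> bounded_linear f \<Longrightarrow> smooth_on S f"
  by (simp add: smooth_on_def Ck_on_linear)

lemma smooth_on_add:
  "open S \<Longrightarrow> smooth_on S f \<Longrightarrow> smooth_on S g \<Longrightarrow> smooth_on S (\<lambda>x. f x + g x)"
  by (simp add: smooth_on_def Ck_on_add)

lemma smooth_on_bilinear:
  "bounded_bilinear B \<Longrightarrow> open S \<Longrightarrow> smooth_on S f \<Longrightarrow> smooth_on S g \<Longrightarrow>
    smooth_on S (\<lambda>x. B (f x) (g x))"
  by (simp add: smooth_on_def Ck_on_bilinear)

lemma smooth_on_inverse_sqrt: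
  fixes f :: "'a::real_normed_vector \<Rightarrow> real"
  shows "open S \<Longrightarrow> smooth_on S f \<Longrightarrow> (\<And>x. x \<in> S \<Longrightarrow> f x > 0) \<Longrightarrow>
    smooth_on S (\<lambda>x. inverse (sqrt (f x)))"
  by (simp add: smooth_on_def Ck_on_inverse_sqrt)

lemma smooth_on_compose_linear:
  "bounded_linear L \<Longrightarrow> open S \<Longrightarrow> open V \<Longrightarrow> L ` V \<subseteq> S \<Longrightarrow> smooth_on S f \<Longrightarrow>
    smooth_on V (\<lambda>x. f (L x))"
  unfolding smooth_on_def using Ck_on_compose_linear by blast

text \<open>The device by which identities such as \<langle>v, T\<rangle> = 0, valid on an open set,
  are differentiated.\<close>

lemma has_derivative_const_on_open:
  assumes "(f has_derivative f') (at x)" "open S" "x \<in> S" "\<And>y. y \<in> S \<Longrightarrow> f y = c"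
  shows "f' h = 0"
proof -
  have "(f has_derivative (\<lambda>h. 0)) (at x)"
    using assms(2-4) by (intro has_derivative_transform_within_open[OF has_derivative_const]) auto
  then show ?thesis using has_derivative_unique[OF assms(1)] by metis
qed

section \<open>Lorentzian linear algebra\<close>

lemma bounded_bilinear_lorentz: "bounded_bilinear lorentz"
  unfolding bilinear_conv_bounded_bilinear[symmetric] bilinear_def
  by (auto intro!: linearI simp: lorentz_def algebra_simps)

interpretation lorentz: bounded_bilinear lorentz
  by (rule bounded_bilinear_lorentz)

lemmas lorentz_algebra = lorentz.add_left lorentz.add_right lorentz.diff_left lorentz.diff_right
  lorentz.scaleR_left lorentz.scaleR_right lorentz.minus_left lorentz.minus_right

lemma lorentz_commute: "lorentz u v = lorentz v u"
  by (simp add: lorentz_def algebra_simps)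

text \<open>The Euclidean cross product with its third entry negated, so that
  \<open>lorentz u (lorentz_cross v w)\<close> is the determinant of \<open>u\<close>,
  \<open>v\<close>, \<open>w\<close>.\<close>

definition lorentz_cross :: "real^3 \<Rightarrow> real^3 \<Rightarrow> real^3" where
  "lorentz_cross u v = vector [u$2 * v$3 - u$3 * v$2, u$3 * v$1 - u$1 * v$3, u$2 * v$1 - u$1 * v$2]"

lemma lorentz_cross_orth [simp]:
  "lorentz (lorentz_cross u v) u = 0" "lorentz (lorentz_cross u v) v = 0"
  "lorentz u (lorentz_cross u v) = 0" "lorentz v (lorentz_cross u v) = 0"
  by (simp_all add: lorentz_def lorentz_cross_def algebra_simps)

lemma lorentz_cross_cyclic: "lorentz u (lorentz_cross v w) = lorentz v (lorentz_cross w u)"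
  by (simp add: lorentz_def lorentz_cross_def algebra_simps)

lemma lorentz_cross_norm:
  "lorentz (lorentz_cross u v) (lorentz_cross u v) = (lorentz u v)^2 - lorentz u u * lorentz v v"
  by (simp add: lorentz_def lorentz_cross_def algebra_simps power2_eq_square)

text \<open>Cramer's rule in division-free form. It serves in two directions: a vector orthogonal to
  three vectors with nonzero determinant is zero, and three vectors orthogonal to a nonzero vector
  have determinant zero.\<close>

lemma lorentz_cramer:
  "lorentz u (lorentz_cross v w) *\<^sub>R x =
     lorentz x u *\<^sub>R lorentz_cross v w + lorentz x v *\<^sub>R lorentz_cross w u
       + lorentz x w *\<^sub>R lorentz_cross u v"
  by (simp add: vec_eq_iff forall_3 lorentz_def lorentz_cross_def algebra_simps)

text \<open>The left side is the Gram determinant of \<open>x\<close>, \<open>y\<close>,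
  \<open>z\<close>; the minus sign is the determinant of the form itself.\<close>

lemma lorentz_gram:
  fixes x y z :: "real^3"
  shows "lorentz x x * (lorentz y y * lorentz z z - (lorentz y z)^2)
     - lorentz x y * (lorentz x y * lorentz z z - lorentz y z * lorentz x z)
     + lorentz x z * (lorentz x y * lorentz y z - lorentz y y * lorentz x z)
     = - ((lorentz x (lorentz_cross y z))^2)"
  unfolding lorentz_def lorentz_cross_def vector_3 by algebra

lemma ex_orthogonal_unit:
  assumes "\<epsilon>\<^sub>T \<in> {-1, 1}" "\<epsilon> \<in> {-1, 1}" "\<epsilon> = -1 \<longrightarrow> \<epsilon>\<^sub>T = 1" "lorentz T T = \<epsilon>\<^sub>T"
  shows "\<exists>v. lorentz v T = 0 \<and> lorentz v v = \<epsilon>"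
proof -
  define \<rho> where "\<rho> = (T$1)^2 + (T$2)^2"
  have T: "\<rho> = (T$3)^2 + \<epsilon>\<^sub>T" and \<rho>0: "\<rho> \<ge> 0"
    using assms(4) by (auto simp: \<rho>_def lorentz_def power2_eq_square)
  \<comment> \<open>The case \<rho> = 0, \<epsilon> = -1 cannot occur: \<open>T\<close> would be
    spacelike, whence \<rho> \<ge> 1.\<close>
  consider "\<rho> = 0" "\<epsilon> = 1" | "\<rho> > 0" "\<epsilon> = 1" | "\<epsilon> = -1" "\<rho> > 0" "\<rho> = (T$3)^2 + 1"
    using assms T \<rho>0 by (smt (verit) insert_iff empty_iff zero_le_power2)
  then show ?thesis
  proof cases
    case 1
    then have "T$1 = 0" "T$2 = 0" by (auto simp: \<rho>_def sum_power2_eq_zero_iff)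
    then show ?thesis using 1
      by (intro exI[of _ "vector [1, 0, 0]"]) (simp add: lorentz_def)
  next
    case 2
    \<comment> \<open>The horizontal part of \<open>T\<close> turned by a right angle.\<close>
    let ?v = "vector [- T$2, T$1, 0] :: real^3"
    have "lorentz ?v T = 0" "lorentz ?v ?v = \<rho>"
      by (simp_all add: lorentz_def \<rho>_def power2_eq_square)
    then show ?thesis using 2
      by (intro exI[of _ "inverse (sqrt \<rho>) *\<^sub>R ?v"]) (simp add: lorentz_algebra field_simps)
  next
    case 3
    \<comment> \<open>The projection of the third basis vector to the orthogonal complement of the
      spacelike \<open>T\<close>; its third entry 1 + \<open>(T$3)^2\<close> is \<rho>.\<close>
    let ?v = "vector [T$1 * T$3, T$2 * T$3, \<rho>] :: real^3"
    have "lorentz ?v T = 0"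
      by (simp add: lorentz_def \<rho>_def power2_eq_square algebra_simps)
    moreover have "lorentz ?v ?v = \<rho> * ((T$3)^2 - \<rho>)"
      by (simp add: lorentz_def \<rho>_def power2_eq_square algebra_simps)
    ultimately show ?thesis using 3
      by (intro exI[of _ "inverse (sqrt \<rho>) *\<^sub>R ?v"]) (simp add: lorentz_algebra field_simps)
  qed
qed

text \<open>The normalized segment between two points of a branch stays on the branch.\<close>

lemma normal_section_connected_component:
  assumes \<epsilon>: "\<epsilon> \<in> {-1, 1}" and r: "r > 0"
    and x: "\<gamma> s + x \<in> normal_section \<gamma> r \<epsilon> s" and y: "\<gamma> s + y \<in> normal_section \<gamma> r \<epsilon> s"
    and pos: "\<epsilon> * lorentz x y > 0"
  shows "connected_component (normal_section \<gamma> r \<epsilon> s) (\<gamma> s + x) (\<gamma> s + y)"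
proof -
  define z where "z \<tau> = (1 - \<tau>) *\<^sub>R x + \<tau> *\<^sub>R y" for \<tau> :: real
  define f where "f \<tau> = \<gamma> s + (r * inverse (sqrt (\<epsilon> * lorentz (z \<tau>) (z \<tau>)))) *\<^sub>R z \<tau>" for \<tau>
  have \<epsilon>2: "\<epsilon> * \<epsilon> = 1" using \<epsilon> by auto
  \<comment> \<open>The mixed term has the sign of \<open>pos\<close> on the unit interval, and the
    squares of 1 - \<tau> and \<tau> never vanish together. So the root in \<open>f\<close> is taken
    of a positive number all along the segment.\<close>
  have n: "\<epsilon> * lorentz (z \<tau>) (z \<tau>) = ((1 - \<tau>)^2 + \<tau>^2) * r^2 + 2 * (\<tau> * (1 - \<tau>)) * (\<epsilon> * lorentz x y)" for \<tau>
  proof -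
    have "lorentz (z \<tau>) (z \<tau>) =
        (1 - \<tau>)^2 * lorentz x x + \<tau>^2 * lorentz y y + 2 * (\<tau> * (1 - \<tau>)) * lorentz x y"
      unfolding z_def
      by (simp add: lorentz_algebra lorentz_commute[of y x] power2_eq_square algebra_simps)
    also have "\<dots> = (1 - \<tau>)^2 * (\<epsilon> * r^2) + \<tau>^2 * (\<epsilon> * r^2) + 2 * (\<tau> * (1 - \<tau>)) * lorentz x y"
      using x y by (simp add: normal_section_def)
    finally have zz: "lorentz (z \<tau>) (z \<tau>) = \<dots>" .
    have "\<epsilon> * lorentz (z \<tau>) (z \<tau>) =
        (\<epsilon> * \<epsilon>) * (((1 - \<tau>)^2 + \<tau>^2) * r^2) + 2 * (\<tau> * (1 - \<tau>)) * (\<epsilon> * lorentz x y)"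
      unfolding zz by (simp add: algebra_simps)
    then show ?thesis by (simp add: \<epsilon>2)
  qed
  have npos: "\<epsilon> * lorentz (z \<tau>) (z \<tau>) > 0" if "\<tau> \<in> {0..1}" for \<tau>
  proof -
    have "(1 - \<tau>)^2 + \<tau>^2 > 0"
      by (simp add: sum_power2_gt_zero_iff)
    then have "((1 - \<tau>)^2 + \<tau>^2) * r^2 > 0" using r by simp
    moreover have "2 * (\<tau> * (1 - \<tau>)) * (\<epsilon> * lorentz x y) \<ge> 0"
      using that pos by (intro mult_nonneg_nonneg[OF _ less_imp_le[OF pos]]) auto
    ultimately show ?thesis unfolding n by (rule add_pos_nonneg)
  qed
  have mem: "f \<tau> \<in> normal_section \<gamma> r \<epsilon> s" if "\<tau> \<in> {0..1}" for \<tau>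
  proof -
    have "lorentz (z \<tau>) (velocity \<gamma> s) = 0"
      using x y by (simp add: z_def normal_section_def lorentz_algebra)
    moreover have "(inverse (sqrt (\<epsilon> * lorentz (z \<tau>) (z \<tau>))))^2 * lorentz (z \<tau>) (z \<tau>) = \<epsilon>"
      using npos[OF that] \<epsilon> by (auto simp: field_simps)
    ultimately show ?thesis
      by (simp add: f_def normal_section_def lorentz_algebra power2_eq_square algebra_simps)
  qed
  have cz: "continuous_on A z" for A unfolding z_def by (intro continuous_intros)
  have "continuous_on {0..1} f"
    unfolding f_def using npos
    by (intro continuous_intros lorentz.continuous_on cz) force
  then have "connected (f ` {0..1})"
    by (intro connected_continuous_image) auto
  moreover have "f ` {0..1} \<subseteq> normal_section \<gamma> r \<epsilon> s" using mem by auto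
  moreover have "f 0 = \<gamma> s + x" "f 1 = \<gamma> s + y"
    using r by (simp_all add: f_def n) (simp_all add: z_def)
  ultimately show ?thesis
    by (metis atLeastAtMost_iff connected_componentI image_eqI order.refl zero_le_one)
qed

section \<open>Curvatures of tubular surfaces\<close>

lemma central_curveD:
  assumes "central_curve a b \<gamma> \<epsilon>\<^sub>T"
  shows "smooth_on (einterval a b) \<gamma>" "smooth_on (einterval a b) (velocity \<gamma>)"
proof -
  show "smooth_on (einterval a b) \<gamma>" using assms by (simp add: central_curve_def)
  then show "smooth_on (einterval a b) (velocity \<gamma>)"
    using smooth_on_vector_derivative[OF open_einterval] by (simp add: velocity_def[abs_def])
qed

lemma central_curve_derivative:
  assumes "central_curve a b \<gamma> \<epsilon>\<^sub>T" "s \<in> einterval a b"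
  shows "(\<gamma> has_derivative (\<lambda>h. h *\<^sub>R velocity \<gamma> s)) (at s)"
    and "(velocity \<gamma> has_derivative (\<lambda>h. h *\<^sub>R acceleration \<gamma> s)) (at s)"
    and "lorentz (velocity \<gamma> s) (velocity \<gamma> s) = \<epsilon>\<^sub>T"
    and "lorentz (acceleration \<gamma> s) (velocity \<gamma> s) = 0"
proof -
  show "(\<gamma> has_derivative (\<lambda>h. h *\<^sub>R velocity \<gamma> s)) (at s)"
    using smooth_on_has_vector_derivative[OF central_curveD(1)[OF assms(1)] assms(2)]
    by (simp add: velocity_def)
  show T: "(velocity \<gamma> has_derivative (\<lambda>h. h *\<^sub>R acceleration \<gamma> s)) (at s)"
    using smooth_on_has_vector_derivative[OF central_curveD(2)[OF assms(1)] assms(2)]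
    by (simp add: acceleration_def)
  show "lorentz (velocity \<gamma> s) (velocity \<gamma> s) = \<epsilon>\<^sub>T"
    using assms by (simp add: central_curve_def)
  have "lorentz (velocity \<gamma> s) (1 *\<^sub>R acceleration \<gamma> s)
      + lorentz (1 *\<^sub>R acceleration \<gamma> s) (velocity \<gamma> s) = 0"
    using assms
    by (intro has_derivative_const_on_open[OF lorentz.FDERIV[OF T T] open_einterval assms(2)])
      (auto simp: central_curve_def)
  then show "lorentz (acceleration \<gamma> s) (velocity \<gamma> s) = 0"
    by (simp add: lorentz_commute)
qed

lemma tubular_surfaceD:
  assumes "tubular_surface a b \<gamma> \<epsilon>\<^sub>T r \<epsilon> P" "(s, v) \<in> P"
  shows "s \<in> einterval a b" "\<gamma> s + v \<in> normal_section \<gamma> r \<epsilon> s"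
  using assms connected_component_subset unfolding tubular_surface_def by fast+

text \<open>The two equations of the normal section, differentiated along the chart. The first gives
  the component of a tangent vector along the central curve, the second says that v is normal to the
  surface.\<close>

lemma tubular_tangent:
  assumes tub: "tubular_surface a b \<gamma> \<epsilon>\<^sub>T r \<epsilon> P"
    and U: "open U" "p \<in> U" "\<forall>q\<in>U. (fst q, \<psi> q - \<gamma> (fst q)) \<in> P"
    and \<psi>': "(\<psi> has_derivative \<psi>') (at p)"
  shows "((\<lambda>q. \<psi> q - \<gamma> (fst q)) has_derivative (\<lambda>h. \<psi>' h - fst h *\<^sub>R velocity \<gamma> (fst p))) (at p)"
    and "lorentz (\<psi>' h) (velocity \<gamma> (fst p)) =
        fst h * (\<epsilon>\<^sub>T - lorentz (acceleration \<gamma> (fst p)) (\<psi> p - \<gamma> (fst p)))"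
    and "lorentz (\<psi>' h) (\<psi> p - \<gamma> (fst p)) = 0"
proof -
  let ?s = "fst p" let ?T = "velocity \<gamma> ?s" let ?V = "\<lambda>q. \<psi> q - \<gamma> (fst q)"
  have cc: "central_curve a b \<gamma> \<epsilon>\<^sub>T" using tub by (simp add: tubular_surface_def)
  have s: "?s \<in> einterval a b" using tubular_surfaceD(1)[OF tub bspec[OF U(3,2)]] .
  note D = central_curve_derivative[OF cc s]
  note fst' = has_derivative_fst[OF has_derivative_ident]
  have N: "lorentz (?V q) (velocity \<gamma> (fst q)) = 0" "lorentz (?V q) (?V q) = \<epsilon> * r^2"
    if "q \<in> U" for q
    using tubular_surfaceD(2)[OF tub bspec[OF U(3) that]] by (auto simp: normal_section_def)
  show V': "(?V has_derivative (\<lambda>h. \<psi>' h - fst h *\<^sub>R ?T)) (at p)"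
    by (rule has_derivative_diff[OF \<psi>' has_derivative_compose[OF fst' D(1)]])
  have "lorentz (?V p) (fst h *\<^sub>R acceleration \<gamma> ?s) + lorentz (\<psi>' h - fst h *\<^sub>R ?T) ?T = 0"
    by (rule has_derivative_const_on_open[OF
          lorentz.FDERIV[OF V' has_derivative_compose[OF fst' D(2)]] U(1,2)]) (rule N(1))
  then show "lorentz (\<psi>' h) ?T = fst h * (\<epsilon>\<^sub>T - lorentz (acceleration \<gamma> ?s) (?V p))"
    using D(3) by (simp add: lorentz_algebra lorentz_commute algebra_simps)
  have "lorentz (?V p) (\<psi>' h - fst h *\<^sub>R ?T) + lorentz (\<psi>' h - fst h *\<^sub>R ?T) (?V p) = 0"
    by (rule has_derivative_const_on_open[OF lorentz.FDERIV[OF V' V'] U(1,2)]) (rule N(2))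
  then have "lorentz (\<psi>' h - fst h *\<^sub>R ?T) (?V p) = 0"
    using lorentz_commute[of "?V p"] by simp
  then show "lorentz (\<psi>' h) (?V p) = 0"
    using N(1)[OF U(2)] lorentz_commute[of ?T "?V p"] by (simp only: lorentz_algebra) simp
qed

lemma tubular_curvatures:
  assumes tub: "tubular_surface a b \<gamma> \<epsilon>\<^sub>T r \<epsilon> P" and lp: "local_parametrization \<gamma> P U \<psi>"
    and p: "p \<in> U" and nz: "metric_det \<psi> p \<noteq> 0"
    and m_def: "m = \<epsilon>\<^sub>T - lorentz (acceleration \<gamma> (fst p)) (\<psi> p - \<gamma> (fst p))"
  shows "gauss_curvature \<gamma> r \<epsilon> \<psi> p = \<epsilon> / r^2 * (1 - \<epsilon>\<^sub>T / m)"
    and "mean_curvature \<gamma> r \<epsilon> \<psi> p = \<epsilon> / (2 * r) * (2 - \<epsilon>\<^sub>T / m)"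
proof -
  have U: "open U" "\<forall>q\<in>U. (fst q, \<psi> q - \<gamma> (fst q)) \<in> P" and sm: "smooth_on U \<psi>"
    using lp by (auto simp: local_parametrization_def)
  have r: "r > 0" and \<epsilon>: "\<epsilon> \<noteq> 0" and \<epsilon>T: "\<epsilon>\<^sub>T * \<epsilon>\<^sub>T = 1" and cc: "central_curve a b \<gamma> \<epsilon>\<^sub>T"
    using tub by (auto simp: tubular_surface_def central_curve_def)
  let ?s = "fst p"
  define T where "T = velocity \<gamma> ?s"
  define V where "V = \<psi> p - \<gamma> ?s"
  define A where "A = partial_s \<psi> p"
  define B where "B = partial_t \<psi> p"
  define E where "E = lorentz A A"
  define F where "F = lorentz A B"
  define G where "G = lorentz B B"
  define D where "D = E * G - F^2"
  have Fr: "(\<psi> has_derivative frechet_derivative \<psi> (at q)) (at q)" if "q \<in> U" for q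
    using smooth_on_has_derivative[OF sm that] .
  note tan = tubular_tangent[OF tub U(1) _ U(2) Fr]
  have s: "?s \<in> einterval a b" using tubular_surfaceD(1)[OF tub bspec[OF U(2) p]] .
  have TT: "lorentz T T = \<epsilon>\<^sub>T" using central_curve_derivative(3)[OF cc s] by (simp add: T_def)
  have VV: "lorentz V V = \<epsilon> * r^2" and VT: "lorentz V T = 0"
    using tubular_surfaceD(2)[OF tub bspec[OF U(2) p]] by (auto simp: normal_section_def V_def T_def)
  have AT: "lorentz A T = m" and BT: "lorentz B T = 0" and AV: "lorentz A V = 0" and BV: "lorentz B V = 0"
    using tan(2)[OF p p, of "(1, 0)"] tan(2)[OF p p, of "(0, 1)"]
      tan(3)[OF p p, of "(1, 0)"] tan(3)[OF p p, of "(0, 1)"]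
    by (simp_all add: A_def B_def T_def V_def m_def partial_s_def partial_t_def)
  \<comment> \<open>Every partial derivative \<open>X\<close> of the chart is orthogonal to v
    throughout \<open>U\<close>. Differentiating this relation trades second derivatives of the
    chart for products of first ones.\<close>
  have second: "lorentz (frechet_derivative X (at p) h) V = fst h * lorentz (X p) T
      - lorentz (X p) (frechet_derivative \<psi> (at p) h)"
    if X: "X = (\<lambda>q. frechet_derivative \<psi> (at q) k)" for X h k
  proof -
    have X': "(X has_derivative frechet_derivative X (at p)) (at p)"
      using smooth_on_has_derivative[OF smooth_on_derivative[OF sm] p] X by simp
    have "lorentz (X p) (frechet_derivative \<psi> (at p) h - fst h *\<^sub>R velocity \<gamma> (fst p))
        + lorentz (frechet_derivative X (at p) h) (\<psi> p - \<gamma> (fst p)) = 0"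
      by (rule has_derivative_const_on_open[OF lorentz.FDERIV[OF X' tan(1)[OF p p]] U(1) p])
        (simp add: X tan(3))
    then show ?thesis by (simp add: lorentz_algebra V_def T_def)
  qed
  have AB: "frechet_derivative \<psi> (at p) (1, 0) = A" "frechet_derivative \<psi> (at p) (0, 1) = B"
    by (simp_all add: A_def B_def partial_s_def partial_t_def)
  have ps: "partial_s \<psi> = (\<lambda>q. frechet_derivative \<psi> (at q) (1, 0))"
    and pt: "partial_t \<psi> = (\<lambda>q. frechet_derivative \<psi> (at q) (0, 1))"
    by (simp_all add: partial_s_def partial_t_def fun_eq_iff)
  have ss: "lorentz (partial_s (partial_s \<psi>) p) V = m - E"
    using second[OF ps, of "(1, 0)"] AT
    by (simp add: partial_s_def[of "partial_s \<psi>"] AB A_def[symmetric] E_def)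
  have st: "lorentz (partial_t (partial_s \<psi>) p) V = - F"
    using second[OF ps, of "(0, 1)"]
    by (simp add: partial_t_def[of "partial_s \<psi>"] AB A_def[symmetric] F_def)
  have tt: "lorentz (partial_t (partial_t \<psi>) p) V = - G"
    using second[OF pt, of "(0, 1)"]
    by (simp add: partial_t_def[of "partial_t \<psi>"] AB B_def[symmetric] G_def)
  \<comment> \<open>The nonzero vector \<open>V\<close> is orthogonal to \<open>A\<close>,
    \<open>B\<close> and \<open>T\<close>, so these are linearly dependent and their Gram
    determinant vanishes.\<close>
  have "lorentz A (lorentz_cross B T) *\<^sub>R V = 0"
    using AV BV VT by (simp add: lorentz_cramer lorentz_commute[of V])
  moreover have "V \<noteq> 0" using VV r \<epsilon> by (auto simp: lorentz.zero_left)
  ultimately have "lorentz A (lorentz_cross B T) = 0" by simp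
  then have "E * (G * \<epsilon>\<^sub>T) - F * (F * \<epsilon>\<^sub>T) - m * (G * m) = 0"
    using lorentz_gram[of A B T] by (simp add: TT AT BT E_def F_def G_def)
  then have "\<epsilon>\<^sub>T * (\<epsilon>\<^sub>T * D) = \<epsilon>\<^sub>T * (m^2 * G)"
    by (simp add: D_def power2_eq_square algebra_simps)
  then have D: "D = \<epsilon>\<^sub>T * m^2 * G" using \<epsilon>T by (simp add: mult.assoc[symmetric])
  have det: "metric_det \<psi> p = D"
    by (simp add: metric_det_def D_def E_def F_def G_def A_def B_def Let_def)
  with nz D have nz: "D \<noteq> 0" "m \<noteq> 0" "G \<noteq> 0" by auto
  \<comment> \<open>This makes both curvature numerators multiples of \<open>D\<close>, which then
    cancels against the determinant of the metric.\<close>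
  have mG: "m * G = D * (\<epsilon>\<^sub>T / m)"
    using nz \<epsilon>T by (simp add: D power2_eq_square field_simps)
  have N: "unit_normal \<gamma> r \<psi> p = - (V /\<^sub>R r)" by (simp add: unit_normal_def V_def)
  have N: "lorentz X (unit_normal \<gamma> r \<psi> p) = - lorentz X V / r" for X
    by (simp add: unit_normal_def V_def[symmetric] lorentz_algebra divide_inverse mult.commute)
  have "(E - m) / r * (G / r) - (F / r)^2 = ((E - m) * G - F^2) / r^2"
    using r by (simp add: field_simps power2_eq_square)
  also have "(E - m) * G - F^2 = D * (1 - \<epsilon>\<^sub>T / m)"
    using mG by (simp add: right_diff_distrib left_diff_distrib D_def)
  finally have num_K: "(E - m) / r * (G / r) - (F / r)^2 = D * (1 - \<epsilon>\<^sub>T / m) / r^2" .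
  have "(E - m) / r * G - 2 * (F / r) * F + G / r * E = ((E - m) * G - 2 * F^2 + G * E) / r"
    using r by (simp add: field_simps power2_eq_square)
  also have "(E - m) * G - 2 * F^2 + G * E = D * 2 - m * G"
    by (simp add: D_def algebra_simps)
  also have "\<dots> = D * (2 - \<epsilon>\<^sub>T / m)"
    by (simp only: mG right_diff_distrib)
  finally have num_H: "(E - m) / r * G - 2 * (F / r) * F + G / r * E = D * (2 - \<epsilon>\<^sub>T / m) / r" .
  have "gauss_curvature \<gamma> r \<epsilon> \<psi> p = \<epsilon> * (((E - m) / r * (G / r) - (F / r)^2) / D)"
    by (simp add: gauss_curvature_def Let_def det N ss st tt)
  then show "gauss_curvature \<gamma> r \<epsilon> \<psi> p = \<epsilon> / r^2 * (1 - \<epsilon>\<^sub>T / m)"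
    unfolding num_K using nz(1) by simp
  have "mean_curvature \<gamma> r \<epsilon> \<psi> p =
      \<epsilon> * (((E - m) / r * G - 2 * (F / r) * F + G / r * E) / (2 * D))"
    by (simp add: mean_curvature_def Let_def det N ss st tt A_def[symmetric] B_def[symmetric]
        E_def[symmetric] F_def[symmetric] G_def[symmetric])
  then show "mean_curvature \<gamma> r \<epsilon> \<psi> p = \<epsilon> / (2 * r) * (2 - \<epsilon>\<^sub>T / m)"
    unfolding num_H using nz(1) by simp
qed

section \<open>Existence of local parametrizations\<close>

text \<open>Unifies full sections and single branches: on the normal sections, membership in
  \<open>P\<close> is implied by an open condition \<open>k > 0\<close>, which holds at some point
  over \<open>s0\<close>. A chart of the full sections can then be cut down to an open set.\<close>

lemma tubular_surface_open_condition:
  assumes tub: "tubular_surface a b \<gamma> \<epsilon>\<^sub>T r \<epsilon> P" and s0: "s0 \<in> einterval a b"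
  obtains v0 k where "\<gamma> s0 + v0 \<in> normal_section \<gamma> r \<epsilon> s0"
    and "continuous_on (einterval a b \<times> UNIV) k" and "k (s0, v0) > (0::real)"
    and "\<forall>s v. s \<in> einterval a b \<and> \<gamma> s + v \<in> normal_section \<gamma> r \<epsilon> s \<and> k (s, v) > 0 \<longrightarrow> (s, v) \<in> P"
proof -
  let ?I = "einterval a b"
  have cc: "central_curve a b \<gamma> \<epsilon>\<^sub>T" and r: "r > 0" and \<epsilon>: "\<epsilon> \<in> {-1, 1}" and \<epsilon>': "\<epsilon> = -1 \<longrightarrow> \<epsilon>\<^sub>T = 1"
    using tub by (auto simp: tubular_surface_def)
  obtain X where P: "P = {(s, v). s \<in> ?I \<and> \<gamma> s + v \<in> X s}"
    and X: "(\<forall>s\<in>?I. X s = normal_section \<gamma> r \<epsilon> s) \<or>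
         (\<exists>w. continuous_on ?I w \<and> (\<forall>s\<in>?I. w s \<in> normal_section \<gamma> r \<epsilon> s \<and>
               X s = connected_component_set (normal_section \<gamma> r \<epsilon> s) (w s)))"
    using tub unfolding tubular_surface_def by auto
  from X show thesis
  proof (elim disjE exE conjE)
    assume X: "\<forall>s\<in>?I. X s = normal_section \<gamma> r \<epsilon> s"
    have "\<epsilon>\<^sub>T \<in> {-1, 1}" using cc by (simp add: central_curve_def)
    then obtain v where "lorentz v (velocity \<gamma> s0) = 0" "lorentz v v = \<epsilon>"
      using ex_orthogonal_unit[OF _ \<epsilon> \<epsilon>' central_curve_derivative(3)[OF cc s0]] by auto
    then have "lorentz (r *\<^sub>R v) (velocity \<gamma> s0) = 0" "lorentz (r *\<^sub>R v) (r *\<^sub>R v) = \<epsilon> * r^2"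
      by (simp_all add: lorentz_algebra power2_eq_square)
    then have "\<gamma> s0 + r *\<^sub>R v \<in> normal_section \<gamma> r \<epsilon> s0"
      by (simp add: normal_section_def)
    then show thesis
      by (rule that[of _ "\<lambda>_. 1"]) (auto simp: P X)
  next
    fix w
    assume w: "continuous_on ?I w"
      and X: "\<forall>s\<in>?I. w s \<in> normal_section \<gamma> r \<epsilon> s \<and>
               X s = connected_component_set (normal_section \<gamma> r \<epsilon> s) (w s)"
    \<comment> \<open>At \<open>w s\<close> itself the value is \<open>r^2\<close>; wherever the
      value is positive, \<open>normal_section_connected_component\<close> joins the point to
      \<open>w s\<close>.\<close>
    let ?k = "\<lambda>(s, v). \<epsilon> * lorentz (w s - \<gamma> s) v"
    show thesis
    proof (rule that[of "w s0 - \<gamma> s0" ?k])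
      show "\<gamma> s0 + (w s0 - \<gamma> s0) \<in> normal_section \<gamma> r \<epsilon> s0" using X s0 by simp
      have "continuous_on ?I \<gamma>" using central_curveD(1)[OF cc] by (rule smooth_on_imp_continuous_on)
      then show "continuous_on (?I \<times> UNIV) ?k"
        unfolding split_def using w
        by (intro continuous_intros lorentz.continuous_on continuous_on_compose2[of ?I _ _ fst]) auto
      have "lorentz (w s0 - \<gamma> s0) (w s0 - \<gamma> s0) = \<epsilon> * r^2"
        using X s0 by (simp add: normal_section_def)
      then show "?k (s0, w s0 - \<gamma> s0) > 0" using r \<epsilon> by auto
      have "(s, v) \<in> P"
        if "s \<in> ?I" "\<gamma> s + v \<in> normal_section \<gamma> r \<epsilon> s" "?k (s, v) > 0" for s v
        using normal_section_connected_component[OF \<epsilon> r _ that(2), where x = "w s - \<gamma> s"] X that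
        by (auto simp: P)
      then show "\<forall>s v. s \<in> ?I \<and> \<gamma> s + v \<in> normal_section \<gamma> r \<epsilon> s \<and> ?k (s, v) > 0 \<longrightarrow> (s, v) \<in> P"
        by blast
    qed
  qed
qed

text \<open>
  The chart projects the line \<open>t \<mapsto> v0 + t u0\<close> of the plane orthogonal to \<open>\<gamma>' s0\<close> to the plane
  orthogonal to \<open>\<gamma>' s\<close> and rescales to the radius. The parameter \<open>t\<close> is recovered as a quotient of
  the triple products of \<open>v\<close> and \<open>\<gamma>' s\<close> with \<open>v0\<close> and \<open>u0\<close>.
\<close>

lemma ex_local_parametrization:
  assumes reg: "regular_tubular_surface a b \<gamma> \<epsilon>\<^sub>T r \<epsilon> P" and s0: "s0 \<in> einterval a b"
  obtains v0 u0 U \<psi> where "local_parametrization \<gamma> P U \<psi>" "(s0, 0) \<in> U"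
    and "lorentz v0 v0 = \<epsilon> * r^2" "lorentz v0 (velocity \<gamma> s0) = 0" "u0 = lorentz_cross (velocity \<gamma> s0) v0"
    and "\<forall>t. (s0, t) \<in> U \<longrightarrow> \<epsilon> * (\<epsilon> * r^2 + t^2 * lorentz u0 u0) > 0"
    and "\<forall>t. (s0, t) \<in> U \<longrightarrow>
      \<psi> (s0, t) - \<gamma> s0 = (r * inverse (sqrt (\<epsilon> * (\<epsilon> * r^2 + t^2 * lorentz u0 u0)))) *\<^sub>R (v0 + t *\<^sub>R u0)"
proof -
  let ?I = "einterval a b"
  have tub: "tubular_surface a b \<gamma> \<epsilon>\<^sub>T r \<epsilon> P"
    and nz: "\<And>s v. (s, v) \<in> P \<Longrightarrow> 1 - \<epsilon>\<^sub>T * lorentz (acceleration \<gamma> s) v \<noteq> 0"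
    using reg by (auto simp: regular_tubular_surface_def)
  have cc: "central_curve a b \<gamma> \<epsilon>\<^sub>T" and r: "r > 0" and \<epsilon>: "\<epsilon> \<in> {-1, 1}" and \<epsilon>T: "\<epsilon>\<^sub>T \<in> {-1, 1}"
    using tub by (auto simp: tubular_surface_def central_curve_def)
  note TT = central_curve_derivative(3)[OF cc]
  obtain v0 k where v0': "\<gamma> s0 + v0 \<in> normal_section \<gamma> r \<epsilon> s0"
    and k: "continuous_on (?I \<times> UNIV) k" "k (s0, v0) > (0::real)"
    and kP: "\<forall>s v. s \<in> ?I \<and> \<gamma> s + v \<in> normal_section \<gamma> r \<epsilon> s \<and> k (s, v) > 0 \<longrightarrow> (s, v) \<in> P"
    using tubular_surface_open_condition[OF tub s0] .
  have v0: "lorentz v0 v0 = \<epsilon> * r^2" "lorentz v0 (velocity \<gamma> s0) = 0"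
    using v0' by (auto simp: normal_section_def)
  \<comment> \<open>Together with \<open>v0\<close> this spans the plane orthogonal to the velocity
    at \<open>s0\<close>; its square is nonzero by \<open>u0u0\<close>.\<close>
  define u0 where "u0 = lorentz_cross (velocity \<gamma> s0) v0"
  have u0: "lorentz u0 v0 = 0" "lorentz v0 u0 = 0" "lorentz u0 (velocity \<gamma> s0) = 0"
    by (simp_all add: u0_def)
  have u0u0: "lorentz u0 u0 = - (\<epsilon>\<^sub>T * (\<epsilon> * r^2))"
    using TT[OF s0] v0 by (simp add: u0_def lorentz_cross_norm lorentz_commute)
  define T where "T q = velocity \<gamma> (fst q)" for q :: "real \<times> real"
  define c where "c q = v0 + snd q *\<^sub>R u0" for q :: "real \<times> real"
  \<comment> \<open>Projection along \<open>T q\<close>. The coefficient contains \<epsilon> of the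
    curve rather than its inverse because the two coincide.\<close>
  define p where "p q = c q + ((- \<epsilon>\<^sub>T) * lorentz (c q) (T q)) *\<^sub>R T q" for q
  define n where "n q = \<epsilon> * lorentz (p q) (p q)" for q
  \<comment> \<open>The determinant of \<open>v0\<close>, \<open>u0\<close> and \<open>T q\<close>.
    Where it is nonzero, the projection is injective on the plane of \<open>v0\<close> and
    \<open>u0\<close>.\<close>
  define d where "d q = lorentz (lorentz_cross v0 u0) (T q)" for q
  define V where "V q = (r * inverse (sqrt (n q))) *\<^sub>R p q" for q
  define \<psi> where "\<psi> q = \<gamma> (fst q) + V q" for q
  define W where "W = ?I \<times> (UNIV :: real set)"
  \<comment> \<open>The domain is cut out in two stages: \<open>V\<close> is known to be continuous
    only where \<open>n\<close> is positive, and only then is the condition on \<open>k\<close>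
    open.\<close>
  define U0 where "U0 = W \<inter> (\<lambda>q. (n q, d q)) -` ({0<..} \<times> (- {0}))"
  define U where "U = U0 \<inter> (\<lambda>q. k (fst q, V q)) -` {0<..}"
  have V: "\<psi> q - \<gamma> (fst q) = V q" for q by (simp add: \<psi>_def)

  have W: "open W" by (auto simp: W_def intro: open_Times)
  have bT: "bounded_linear (\<lambda>x. x *\<^sub>R u0)" by (rule bounded_linear_scaleR_left)
  have smT: "smooth_on W T" and smg: "smooth_on W (\<lambda>q. \<gamma> (fst q))"
    unfolding T_def using central_curveD[OF cc] W
    by (auto intro!: smooth_on_compose_linear[OF bounded_linear_fst open_einterval] simp: W_def)
  have smc: "smooth_on W c"
    unfolding c_def using W
    by (intro smooth_on_add smooth_on_const smooth_on_linear
        bounded_linear_compose[OF bT bounded_linear_snd]) auto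
  have smp: "smooth_on W p"
    unfolding p_def using W smc smT
    by (intro smooth_on_add smooth_on_bilinear[OF bounded_bilinear_scaleR]
        smooth_on_bilinear[OF bounded_bilinear_mult] smooth_on_const
        smooth_on_bilinear[OF bounded_bilinear_lorentz])
  have smn: "smooth_on W n"
    unfolding n_def using W smp
    by (intro smooth_on_bilinear[OF bounded_bilinear_mult] smooth_on_const
        smooth_on_bilinear[OF bounded_bilinear_lorentz])
  have smd: "smooth_on W d"
    unfolding d_def using W smT
    by (intro smooth_on_bilinear[OF bounded_bilinear_lorentz] smooth_on_const)
  have "open U0"
    unfolding U0_def using W
    by (intro continuous_open_preimage continuous_on_Pair smooth_on_imp_continuous_on[OF smn]
        smooth_on_imp_continuous_on[OF smd] open_Times) auto
  have UW: "U0 \<subseteq> W" "U \<subseteq> U0" by (auto simp: U0_def U_def)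
  have smV: "smooth_on U0 V"
    unfolding V_def using \<open>open U0\<close> smooth_on_subset[OF UW(1) smp] smooth_on_subset[OF UW(1) smn]
    by (intro smooth_on_bilinear[OF bounded_bilinear_scaleR] smooth_on_bilinear[OF bounded_bilinear_mult]
        smooth_on_const smooth_on_inverse_sqrt) (auto simp: U0_def)
  have "continuous_on U0 (\<lambda>q. k (fst q, V q))"
    using UW by (intro continuous_on_compose2[OF k(1)] continuous_intros
        smooth_on_imp_continuous_on[OF smV]) (auto simp: W_def)
  then have oU: "open U"
    unfolding U_def using \<open>open U0\<close> by (intro continuous_open_preimage) auto
  have sm: "smooth_on U \<psi>"
    unfolding \<psi>_def using oU smooth_on_subset[OF UW(2) smV] smooth_on_subset[OF subset_trans[OF UW(2,1)] smg]
    by (intro smooth_on_add)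

  have UI: "fst q \<in> ?I" "n q > 0" "d q \<noteq> 0" if "q \<in> U" for q
    using that by (auto simp: U_def U0_def W_def)
  have pT: "lorentz (p q) (T q) = 0" if "q \<in> U" for q
    using TT[OF UI(1)[OF that]] \<epsilon>T by (auto simp: p_def T_def lorentz_algebra)
  have nV: "\<gamma> (fst q) + V q \<in> normal_section \<gamma> r \<epsilon> (fst q)" if "q \<in> U" for q
  proof -
    have "(inverse (sqrt (n q)))^2 * lorentz (p q) (p q) = \<epsilon>"
      using UI(2)[OF that] \<epsilon> by (auto simp: n_def field_simps)
    then show ?thesis
      using pT[OF that]
      by (simp add: normal_section_def V_def T_def lorentz_algebra power2_eq_square algebra_simps)
  qed
  have VP: "(fst q, V q) \<in> P" if "q \<in> U" for q
    using kP UI(1)[OF that] nV[OF that] that by (auto simp: U_def)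
  have dV: "lorentz (V q) (lorentz_cross (T q) v0) = snd q * lorentz (V q) (lorentz_cross u0 (T q))"
    "lorentz (V q) (lorentz_cross u0 (T q)) \<noteq> 0" if "q \<in> U" for q
  proof -
    have d1: "lorentz u0 (lorentz_cross (T q) v0) = d q" and d2: "lorentz v0 (lorentz_cross u0 (T q)) = d q"
      unfolding d_def lorentz_commute[of _ "T q"]
      using lorentz_cross_cyclic[of u0 "T q" v0] lorentz_cross_cyclic[of v0 u0 "T q"] by simp_all
    show "lorentz (V q) (lorentz_cross (T q) v0) = snd q * lorentz (V q) (lorentz_cross u0 (T q))"
      by (simp add: V_def p_def c_def lorentz_algebra d1 d2)
    show "lorentz (V q) (lorentz_cross u0 (T q)) \<noteq> 0"
      using UI(2,3)[OF that] r by (simp add: V_def p_def c_def lorentz_algebra d2)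
  qed
  have inj: "inj (frechet_derivative \<psi> (at q))" if q: "q \<in> U" for q
  proof -
    let ?D = "frechet_derivative \<psi> (at q)"
    have D: "(\<psi> has_derivative ?D) (at q)" using smooth_on_has_derivative[OF sm q] .
    then have lin: "linear ?D" by (rule has_derivative_linear)
    \<comment> \<open>Regularity rules out a kernel vector with nonzero s-component. It remains to
      show that the t-derivative of the chart is nonzero.\<close>
    have "h = 0" if h: "?D h = 0" for h
    proof -
      have "fst h * (\<epsilon>\<^sub>T - lorentz (acceleration \<gamma> (fst q)) (V q)) = 0"
        using tubular_tangent(2)[OF tub oU q _ D, of h] VP h by (simp add: V lorentz.zero_left)
      moreover have "\<epsilon>\<^sub>T - lorentz (acceleration \<gamma> (fst q)) (V q) \<noteq> 0"
        using nz[OF VP[OF q]] \<epsilon>T by auto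
      ultimately have h1: "fst h = 0" by simp
      have "snd h = 0"
      proof (rule ccontr)
        assume h2: "snd h \<noteq> 0"
        have "h = snd h *\<^sub>R (0, 1)" using h1 by (simp add: prod_eq_iff)
        then have "snd h *\<^sub>R ?D (0, 1) = 0" using h linear_scale[OF lin] by metis
        then have D1: "?D (0, 1) = 0" using h2 by simp
        have "?D (0, x) = x *\<^sub>R ?D (0, 1)" for x
          using linear_scale[OF lin, of x "(0, 1)"] by simp
        then have D0: "?D (0, x) = 0" for x using D1 by simp
        let ?\<phi> = "\<lambda>t. \<psi> (fst q, t) - \<gamma> (fst q)"
        let ?A = "lorentz_cross (T q) v0" and ?B = "lorentz_cross u0 (T q)"
        have "((\<lambda>t. (fst q, t)) has_derivative (\<lambda>x. (0, x))) (at (snd q))"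
          by (intro has_derivative_Pair has_derivative_const has_derivative_ident)
        then have "((\<lambda>t. \<psi> (fst q, t)) has_derivative (\<lambda>x. ?D (0, x))) (at (snd q))"
          using has_derivative_compose[of "\<lambda>t. (fst q, t)" _ "snd q" UNIV \<psi> ?D] D by simp
        then have \<phi>': "(?\<phi> has_derivative (\<lambda>x. 0)) (at (snd q))"
          using has_derivative_diff[OF _ has_derivative_const] D0 by fastforce
        \<comment> \<open>This function of t vanishes identically by \<open>dV\<close>. If the
          t-derivative of the chart were zero, its derivative at \<open>snd q\<close> would be the
          negative of the second triple product, which is nonzero.\<close>
        have F: "((\<lambda>t. lorentz (?\<phi> t) ?A - t * lorentz (?\<phi> t) ?B) has_derivative
            (\<lambda>x. (lorentz (?\<phi> (snd q)) 0 + lorentz 0 ?A)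
              - (snd q * (lorentz (?\<phi> (snd q)) 0 + lorentz 0 ?B) + x * lorentz (?\<phi> (snd q)) ?B))) (at (snd q))"
          by (intro has_derivative_diff has_derivative_mult has_derivative_ident
              lorentz.FDERIV \<phi>' has_derivative_const)
        have "(lorentz (?\<phi> (snd q)) 0 + lorentz 0 ?A)
              - (snd q * (lorentz (?\<phi> (snd q)) 0 + lorentz 0 ?B) + 1 * lorentz (?\<phi> (snd q)) ?B) = 0"
        proof (rule has_derivative_const_on_open[OF F, of "(\<lambda>t. (fst q, t)) -` U" 0 1])
          show "open ((\<lambda>t. (fst q, t)) -` U)"
            using oU by (intro open_vimage) (auto intro!: continuous_intros)
          show "lorentz (?\<phi> t) ?A - t * lorentz (?\<phi> t) ?B = 0" if "t \<in> (\<lambda>t. (fst q, t)) -` U" for t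
            using dV(1)[of "(fst q, t)"] V[of "(fst q, t)"] that by (simp add: T_def)
        qed (use q in simp)
        then show False
          using dV(2)[OF q] V[of q] by (simp add: lorentz.zero_left lorentz.zero_right)
      qed
      with h1 show "h = 0" by (simp add: prod_eq_iff)
    qed
    then show ?thesis using linear_injective_0[OF lin] by blast
  qed
  have inj_on: "inj_on (\<lambda>(s, t). (s, \<psi> (s, t) - \<gamma> s)) U"
  proof (rule inj_onI)
    fix q q' assume q: "q \<in> U" "q' \<in> U"
      and eq: "(\<lambda>(s, t). (s, \<psi> (s, t) - \<gamma> s)) q = (\<lambda>(s, t). (s, \<psi> (s, t) - \<gamma> s)) q'"
    then have 1: "fst q = fst q'" "V q = V q'"
      using V[of q] V[of q'] by (auto simp: split_def)
    then have "T q = T q'" by (simp add: T_def)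
    then have "snd q = snd q'" using dV[OF q(1)] dV[OF q(2)] 1 by simp
    with 1 show "q = q'" by (simp add: prod_eq_iff)
  qed
  have lp: "local_parametrization \<gamma> P U \<psi>"
    unfolding local_parametrization_def using oU sm inj inj_on VP V by force
  have ps0: "p (s0, t) = v0 + t *\<^sub>R u0" for t
    using v0 u0 by (simp add: p_def c_def T_def lorentz_algebra)
  have ns0: "n (s0, t) = \<epsilon> * (\<epsilon> * r^2 + t^2 * lorentz u0 u0)" for t
    using v0 u0 by (simp add: n_def ps0 lorentz_algebra power2_eq_square)
  have ds0: "d (s0, t) = lorentz u0 u0" for t
    using lorentz_cross_cyclic[of u0 "velocity \<gamma> s0" v0]
    by (simp add: d_def T_def lorentz_commute u0_def[symmetric])
  have "n (s0, 0) = r^2" using \<epsilon> by (auto simp: ns0)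
  moreover from this have "V (s0, 0) = v0" using r by (simp add: V_def ps0)
  moreover have "d (s0, 0) \<noteq> 0" using \<epsilon> \<epsilon>T r by (auto simp: ds0 u0u0)
  ultimately have "(s0, 0) \<in> U"
    using k(2) s0 r by (simp add: U_def U0_def W_def)
  then show thesis
  proof (rule that[OF lp _ v0 u0_def])
    show "\<forall>t. (s0, t) \<in> U \<longrightarrow> \<epsilon> * (\<epsilon> * r^2 + t^2 * lorentz u0 u0) > 0"
      unfolding ns0[symmetric] using UI(2) by blast
    show "\<forall>t. (s0, t) \<in> U \<longrightarrow> \<psi> (s0, t) - \<gamma> s0 =
        (r * inverse (sqrt (\<epsilon> * (\<epsilon> * r^2 + t^2 * lorentz u0 u0)))) *\<^sub>R (v0 + t *\<^sub>R u0)"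
      using V[of "(s0, _)"] by (simp add: V_def ns0 ps0)
  qed
qed

text \<open>Over \<open>s0\<close> the height is r (A + t B) / sqrt (N t). Its values on an interval
  form a connected set, hence are infinitely many unless it is constant, and constancy would force A
  = B = 0.\<close>

lemma infinite_heights:
  assumes reg: "regular_tubular_surface a b \<gamma> \<epsilon>\<^sub>T r \<epsilon> P" and s0: "s0 \<in> einterval a b"
    and acc: "acceleration \<gamma> s0 \<noteq> 0"
  obtains U \<psi> where "local_parametrization \<gamma> P U \<psi>"
    and "infinite ((\<lambda>p. lorentz (acceleration \<gamma> (fst p)) (\<psi> p - \<gamma> (fst p))) ` {p \<in> U. fst p = s0})"
proof -
  have tub: "tubular_surface a b \<gamma> \<epsilon>\<^sub>T r \<epsilon> P" using reg by (simp add: regular_tubular_surface_def)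
  have cc: "central_curve a b \<gamma> \<epsilon>\<^sub>T" and r: "r > 0" and \<epsilon>: "\<epsilon> \<in> {-1, 1}" and \<epsilon>T: "\<epsilon>\<^sub>T \<in> {-1, 1}"
    using tub by (auto simp: tubular_surface_def central_curve_def)
  obtain v0 u0 U \<psi> where lp: "local_parametrization \<gamma> P U \<psi>" and U0: "(s0, 0) \<in> U"
    and v0: "lorentz v0 v0 = \<epsilon> * r^2" "lorentz v0 (velocity \<gamma> s0) = 0"
    and u0: "u0 = lorentz_cross (velocity \<gamma> s0) v0"
    and pos: "\<forall>t. (s0, t) \<in> U \<longrightarrow> \<epsilon> * (\<epsilon> * r^2 + t^2 * lorentz u0 u0) > 0"
    and \<psi>: "\<forall>t. (s0, t) \<in> U \<longrightarrow>
      \<psi> (s0, t) - \<gamma> s0 = (r * inverse (sqrt (\<epsilon> * (\<epsilon> * r^2 + t^2 * lorentz u0 u0)))) *\<^sub>R (v0 + t *\<^sub>R u0)"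
    using ex_local_parametrization[OF reg s0] .
  define \<eta> where "\<eta> = lorentz u0 u0"
  define N where "N t = \<epsilon> * (\<epsilon> * r^2 + t^2 * \<eta>)" for t
  define A where "A = lorentz (acceleration \<gamma> s0) v0"
  define B where "B = lorentz (acceleration \<gamma> s0) u0"
  define h where "h t = r * inverse (sqrt (N t)) * (A + t * B)" for t
  have "\<eta> = - (\<epsilon>\<^sub>T * (\<epsilon> * r^2))"
    using central_curve_derivative(3)[OF cc s0] v0
    by (simp add: \<eta>_def u0 lorentz_cross_norm lorentz_commute)
  then have \<eta>: "\<eta> \<noteq> 0" using \<epsilon> \<epsilon>T r by auto
  \<comment> \<open>The acceleration is already orthogonal to the velocity; were it orthogonal to
    \<open>v0\<close> and \<open>u0\<close> as well, Cramer's rule with determinant \<eta> would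
    make it zero.\<close>
  have "A \<noteq> 0 \<or> B \<noteq> 0"
  proof (rule ccontr)
    assume "\<not> (A \<noteq> 0 \<or> B \<noteq> 0)"
    then have "lorentz u0 (lorentz_cross (velocity \<gamma> s0) v0) *\<^sub>R acceleration \<gamma> s0 = 0"
      using central_curve_derivative(4)[OF cc s0] by (simp add: lorentz_cramer A_def B_def)
    then show False using \<eta> acc by (simp add: \<eta>_def u0[symmetric])
  qed
  have "open U" using lp by (simp add: local_parametrization_def)
  then have "open ((\<lambda>t. (s0, t)) -` U)"
    by (intro open_vimage) (auto intro!: continuous_intros)
  then obtain e where e: "e > 0" "\<And>t. \<bar>t\<bar> \<le> e \<Longrightarrow> (s0, t) \<in> U"
    using U0 open_contains_cball[of "(\<lambda>t. (s0, t)) -` U"]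
    by (force simp: subset_iff dist_real_def)
  have Npos: "N t > 0" if "t \<in> {-e..e}" for t
    using pos e(2)[of t] that by (auto simp: N_def \<eta>_def)
  have "continuous_on {-e..e} h"
    unfolding h_def using Npos by (force simp: N_def intro!: continuous_intros)
  then have conn: "connected (h ` {-e..e})"
    by (intro connected_continuous_image) auto
  have "infinite (h ` {-e..e})"
  proof
    assume "finite (h ` {-e..e})"
    then obtain c where c: "h ` {-e..e} = {c}"
      using connected_finite_iff_sing[OF conn] e(1) by auto
    have sq: "c^2 * N t = r^2 * (A + t * B)^2" if "t \<in> {-e..e}" for t
    proof -
      have "h t = c" using c that by blast
      then have "c * sqrt (N t) = r * (A + t * B)"
        using Npos[OF that] by (auto simp: h_def field_simps)
      then have "(c * sqrt (N t))^2 = (r * (A + t * B))^2" by simp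
      then show ?thesis using Npos[OF that] by (simp add: power_mult_distrib)
    qed
    have e0: "0 \<in> {-e..e}" "e \<in> {-e..e}" "- e \<in> {-e..e}" using e(1) by auto
    have \<epsilon>2: "\<epsilon> * (\<epsilon> * x) = x" for x using \<epsilon> by auto
    have c2: "c^2 = A^2" using sq[OF e0(1)] r \<epsilon>2 by (simp add: N_def)
    have 1: "A^2 * (r^2 + \<epsilon> * (e^2 * \<eta>)) = r^2 * (A + e * B)^2"
      "A^2 * (r^2 + \<epsilon> * (e^2 * \<eta>)) = r^2 * (A - e * B)^2"
      using sq[OF e0(2)] sq[OF e0(3)] c2 \<epsilon>2 by (simp_all add: N_def distrib_left)
    then have "(A + e * B)^2 = (A - e * B)^2" using r by simp
    then have "A * B = 0" using e(1) by (simp add: power2_eq_square algebra_simps)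
    moreover have "A = 0 \<Longrightarrow> B = 0" "B = 0 \<Longrightarrow> A = 0"
      using 1 e(1) r \<epsilon> \<eta> by (auto simp: distrib_left)
    ultimately show False using \<open>A \<noteq> 0 \<or> B \<noteq> 0\<close> by auto
  qed
  moreover have "h ` {-e..e} \<subseteq>
      (\<lambda>p. lorentz (acceleration \<gamma> (fst p)) (\<psi> p - \<gamma> (fst p))) ` {p \<in> U. fst p = s0}"
  proof
    fix y assume "y \<in> h ` {-e..e}"
    then obtain t where t: "(s0, t) \<in> U" "y = h t" using e(2) by force
    then have "y = lorentz (acceleration \<gamma> s0) (\<psi> (s0, t) - \<gamma> s0)"
      by (simp add: \<psi> h_def N_def \<eta>_def A_def B_def lorentz_algebra)
    with t show "y \<in> (\<lambda>p. lorentz (acceleration \<gamma> (fst p)) (\<psi> p - \<gamma> (fst p))) ` {p \<in> U. fst p = s0}"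
      by force
  qed
  ultimately show thesis using that[OF lp] finite_subset by blast
qed

section \<open>Polynomials vanishing on a line\<close>

lemma poly_poly_eq_eval2: "poly (poly Q p) x = eval2 Q x (poly p x)"
  by (induction Q) (simp_all add: eval2_def)

lemma ideal_generated_singleton: "ideal_generated {g} = range (\<lambda>c. c * g)"
proof -
  interpret module "(*) :: 'a \<Rightarrow> 'a \<Rightarrow> 'a" by (rule module_times)
  show ?thesis by (simp add: ideal_generated_def span_singleton)
qed

text \<open>Substituting \<open>p\<close> for y gives a polynomial in x with infinitely many roots,
  hence zero. So \<open>p\<close> is a root of \<open>Q\<close> over the polynomials in x, and the
  factor theorem applies.\<close>

lemma eval2_zero_on_line:
  assumes "infinite X" "\<And>x. x \<in> X \<Longrightarrow> eval2 Q x (poly p x) = 0"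
  shows "[:- p, 1:] dvd Q"
proof -
  have "poly Q p = 0"
    using assms poly_roots_finite[of "poly Q p"] finite_subset[of X "{x. poly (poly Q p) x = 0}"]
    by (auto simp: poly_poly_eq_eval2)
  then show ?thesis by (simp add: poly_eq_0_iff_dvd)
qed

section \<open>The polynomial relations between the two curvatures\<close>

theorem theorem29:
  fixes a b :: ereal and \<gamma> :: "real \<Rightarrow> real^3" and \<epsilon>\<^sub>T r \<epsilon> :: real
    and P :: "(real \<times> (real^3)) set"
  assumes "regular_tubular_surface a b \<gamma> \<epsilon>\<^sub>T r \<epsilon> P"
    and "nondegenerate \<gamma> P"
  shows "(right_cylinder a b \<gamma> \<epsilon>\<^sub>T r \<epsilon> P \<longrightarrow>
            QL \<gamma> r \<epsilon> P = {Q. r \<in> RadL \<epsilon> Q}) \<and>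
         (\<not> right_cylinder a b \<gamma> \<epsilon>\<^sub>T r \<epsilon> P \<longrightarrow>
            QL \<gamma> r \<epsilon> P =
              ideal_generated {polyX * polyC (r^2) - polyC (2 * r) * polyY + polyC \<epsilon>})"
proof -
  let ?K = "gauss_curvature \<gamma> r \<epsilon>" and ?H = "mean_curvature \<gamma> r \<epsilon>"
  define g where "g = polyX * polyC (r^2) - polyC (2 * r) * polyY + polyC \<epsilon>"
  define m where "m \<psi> p = \<epsilon>\<^sub>T - lorentz (acceleration \<gamma> (fst p)) (\<psi> p - \<gamma> (fst p))"
    for \<psi> and p :: "real \<times> real"
  have tub: "tubular_surface a b \<gamma> \<epsilon>\<^sub>T r \<epsilon> P"
    using assms(1) by (simp add: regular_tubular_surface_def)
  then have cc: "central_curve a b \<gamma> \<epsilon>\<^sub>T" and r: "r > 0" and \<epsilon>: "\<epsilon> \<in> {-1, 1}" and \<epsilon>T: "\<epsilon>\<^sub>T \<in> {-1, 1}"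
    by (auto simp: tubular_surface_def central_curve_def)
  have KH: "?K \<psi> p = \<epsilon> / r^2 * (1 - \<epsilon>\<^sub>T / m \<psi> p)" "?H \<psi> p = \<epsilon> / (2 * r) * (2 - \<epsilon>\<^sub>T / m \<psi> p)"
    and UP: "(fst p, \<psi> p - \<gamma> (fst p)) \<in> P"
    if "local_parametrization \<gamma> P U \<psi>" "p \<in> U" for U \<psi> p
  proof -
    have "metric_det \<psi> p \<noteq> 0" using assms(2) that by (auto simp: nondegenerate_def)
    then show "?K \<psi> p = \<epsilon> / r^2 * (1 - \<epsilon>\<^sub>T / m \<psi> p)" "?H \<psi> p = \<epsilon> / (2 * r) * (2 - \<epsilon>\<^sub>T / m \<psi> p)"
      using tubular_curvatures[OF tub that] by (simp_all add: m_def)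
    show "(fst p, \<psi> p - \<gamma> (fst p)) \<in> P"
      using that by (auto simp: local_parametrization_def)
  qed
  \<comment> \<open>Up to the factor \<plusminus>1 given by the causal character of the curve,
    \<open>m\<close> is the expression in the regularity condition.\<close>
  have m: "m \<psi> p \<noteq> 0" if "local_parametrization \<gamma> P U \<psi>" "p \<in> U" for U \<psi> p
    using assms(1) UP[OF that] \<epsilon>T by (fastforce simp: regular_tubular_surface_def m_def)
  have "QL \<gamma> r \<epsilon> P = {Q. r \<in> RadL \<epsilon> Q}" if cyl: "right_cylinder a b \<gamma> \<epsilon>\<^sub>T r \<epsilon> P"
  proof -
    have "?K \<psi> p = 0 \<and> ?H \<psi> p = \<epsilon> / (2 * r)" if "local_parametrization \<gamma> P U \<psi>" "p \<in> U" for U \<psi> p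
    proof -
      have "acceleration \<gamma> (fst p) = 0"
        using cyl tubular_surfaceD(1)[OF tub UP[OF that]] by (simp add: right_cylinder_def)
      then have "m \<psi> p = \<epsilon>\<^sub>T" by (simp add: m_def lorentz.zero_left)
      then show ?thesis using KH[OF that] \<epsilon>T by auto
    qed
    moreover obtain s0 where s0: "s0 \<in> einterval a b"
      using cc einterval_nonempty unfolding central_curve_def by blast
    \<comment> \<open>A chart must exist, since otherwise every polynomial would satisfy the
      relation vacuously.\<close>
    obtain U \<psi> where "local_parametrization \<gamma> P U \<psi>" "(s0, 0) \<in> U"
      using ex_local_parametrization[OF assms(1) s0] by metis
    ultimately show ?thesis using r by (fastforce simp: QL_def RadL_def)
  qed
  moreover have "QL \<gamma> r \<epsilon> P = ideal_generated {g}" if ncyl: "\<not> right_cylinder a b \<gamma> \<epsilon>\<^sub>T r \<epsilon> P"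
  proof (intro subset_antisym subsetI)
    fix Q assume Q: "Q \<in> QL \<gamma> r \<epsilon> P"
    obtain s0 where s0: "s0 \<in> einterval a b" "acceleration \<gamma> s0 \<noteq> 0"
      using ncyl assms(1) by (auto simp: right_cylinder_def)
    obtain U \<psi> where lp: "local_parametrization \<gamma> P U \<psi>"
      and inf: "infinite ((\<lambda>p. lorentz (acceleration \<gamma> (fst p)) (\<psi> p - \<gamma> (fst p))) ` {p \<in> U. fst p = s0})"
      using infinite_heights[OF assms(1) s0] .
    \<comment> \<open>The formula for K is solved for \<open>m\<close>, so the height is a function
      of K and infinitely many heights require infinitely many values of K.\<close>
    have "(\<lambda>p. lorentz (acceleration \<gamma> (fst p)) (\<psi> p - \<gamma> (fst p))) ` {p \<in> U. fst p = s0}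
        \<subseteq> (\<lambda>x. \<epsilon>\<^sub>T - \<epsilon>\<^sub>T / (1 - x / (\<epsilon> / r^2))) ` (?K \<psi> ` U)"
    proof
      fix y assume "y \<in> (\<lambda>p. lorentz (acceleration \<gamma> (fst p)) (\<psi> p - \<gamma> (fst p))) ` {p \<in> U. fst p = s0}"
      then obtain p where p: "p \<in> U" "y = \<epsilon>\<^sub>T - m \<psi> p" by (auto simp: m_def)
      then have "y = \<epsilon>\<^sub>T - \<epsilon>\<^sub>T / (1 - ?K \<psi> p / (\<epsilon> / r^2))"
        using KH(1)[OF lp p(1)] m[OF lp p(1)] r \<epsilon> \<epsilon>T by auto
      then show "y \<in> (\<lambda>x. \<epsilon>\<^sub>T - \<epsilon>\<^sub>T / (1 - x / (\<epsilon> / r^2))) ` (?K \<psi> ` U)" using p by blast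
    qed
    then have infK: "infinite (?K \<psi> ` U)" using inf finite_subset by blast
    \<comment> \<open>The line solved for y, so that H = \<open>poly l\<close> K.\<close>
    define l where "l = [:\<epsilon> / (2 * r), r / 2:]"
    have "eval2 Q x (poly l x) = 0" if x: "x \<in> ?K \<psi> ` U" for x
    proof -
      obtain p where p: "p \<in> U" "x = ?K \<psi> p" using x by blast
      have "poly l x = ?H \<psi> p"
        using KH[OF lp p(1)] r by (simp add: p(2) l_def power2_eq_square field_simps)
      then show ?thesis using Q lp p by (simp add: QL_def)
    qed
    then have "[:- l, 1:] dvd Q" by (rule eval2_zero_on_line[OF infK])
    then obtain R where R: "Q = [:- l, 1:] * R" by (elim dvdE)
    \<comment> \<open>The generator is y - l(x) times the unit -2r, so divisibility by one is
      divisibility by the other.\<close>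
    have "g = polyC (- (2 * r)) * [:- l, 1:]"
      using r by (simp add: g_def l_def polyX_def polyY_def polyC_def power2_eq_square)
    then have "polyC (- 1 / (2 * r)) * g = (polyC (- 1 / (2 * r)) * polyC (- (2 * r))) * [:- l, 1:]"
      by (simp only: mult.assoc)
    also have "polyC (- 1 / (2 * r)) * polyC (- (2 * r)) = 1"
      using r by (simp add: polyC_def one_pCons)
    finally have "polyC (- 1 / (2 * r)) * g = [:- l, 1:]" by (simp only: mult_1_left)
    then have "Q = (R * polyC (- 1 / (2 * r))) * g" by (simp only: R mult.assoc) (rule mult.commute)
    then show "Q \<in> ideal_generated {g}" unfolding ideal_generated_singleton by blast
  next
    fix Q assume "Q \<in> ideal_generated {g}"
    then obtain R where R: "Q = R * g" unfolding ideal_generated_singleton by blast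
    \<comment> \<open>With u = \<open>\<epsilon>\<^sub>T / m \<psi> p\<close> the three terms are
      \<epsilon> (1 - u), - \<epsilon> (2 - u) and \<epsilon>.\<close>
    have "eval2 g (?K \<psi> p) (?H \<psi> p) = 0" if "local_parametrization \<gamma> P U \<psi>" "p \<in> U" for U \<psi> p
      unfolding g_def eval2_simps KH[OF that] using r by (simp add: field_simps power2_eq_square)
    then show "Q \<in> QL \<gamma> r \<epsilon> P" by (simp add: QL_def R)
  qed
  ultimately show ?thesis by (simp add: g_def)
qed

end
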